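(* Let $\mathbf{L}=(\mathbf{A},G,H,F,P)$ be a tense DLI$^{+}$-algebra with $G(0)=0=H(0)$. Then the map $f:\mathsf{Con}(\mathbf{L})\to\mathsf{Con}(\mathrm{K}(\mathbf{L}))$ defined by $f(\theta)=\gamma_\theta$, where $(a,b)\,\gamma_\theta\,(x,y)$ iff $(a,x)\in\theta$ and $(b,y)\in\theta$, is an order isomorphism.
   Context: A DLI$^{+}$-algebra is $\langle A,\wedge,\vee,\to,0,1\rangle$ with bounded distributive lattice reduct such that $(a\to b)\wedge(a\to d)=a\to(b\wedge d)$, $(a\to d)\wedge(b\to d)=(a\vee b)\to d$, $0\to a=1$, $a\to 1=1$, $a\wedge(a\to b)\le b$. A tense DLI$^{+}$-algebra is $(\mathbf{A},G,H,F,P)$ with unary operations satisfying: $P(x)\le y$ iff $x\le G(y)$; $F(x)\le y$ iff $x\le H(y)$; $G(x)\wedge F(y)\le F(x\wedge y)$, $H(x)\wedge P(y)\le P(x\wedge y)$; $G(x\vee y)\le G(x)\vee F(y)$, $H(x\vee y)\le H(x)\vee P(y)$; $G(x\to y)\le G(x)\to G(y)$, $H(x\to y)\le H(x)\to H(y)$; $G(x\to y)\le F(x)\to F(y)$, $H(x\to y)\le P(x)\to P(y)$. $\mathsf{Con}(\mathbf{L})$ is the lattice of congruences of $\mathbf{L}$ (compatible with $\wedge,\vee,\to,0,1,G,H,F,P$). $\mathrm{K}(\mathbf{L})$ is the algebra on $K(A)=\{(a,b)\in A^2:a\wedge b=0\}$ with $(a,b)\vee(x,y)=(a\vee x,b\wedge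 y)$, $(a,b)\wedge(x,y)=(a\wedge x,b\vee y)$, $(a,b)\Rightarrow(x,y)=((a\to x)\wedge(y\to b),a\wedge y)$, $\sim(a,b)=(b,a)$, $0=(0,1)$, $1=(1,0)$, $c=(0,0)$, $G_K(a,b)=(G(a),F(b))$, $H_K(a,b)=(H(a),P(b))$; $\mathsf{Con}(\mathrm{K}(\mathbf{L}))$ is its lattice of congruences with respect to all these operations. Both are ordered by inclusion. *)

theory Defs
  imports Main
begin

unbundle lattice_syntax

text \<open>The universe of an algebra is the whole type; its bounded distributive lattice reduct is the
  type class structure, with \<open>\<bottom>\<close> and \<open>\<top>\<close> for 0 and 1.\<close>

locale dli_plus =
  fixes imp :: "'a::{distrib_lattice, bounded_lattice} \<Rightarrow> 'a \<Rightarrow> 'a" (infixr "\<rightarrow>" 75)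
  assumes imp_inf: "(a \<rightarrow> b) \<sqinter> (a \<rightarrow> d) = a \<rightarrow> (b \<sqinter> d)"
    and sup_imp: "(a \<rightarrow> d) \<sqinter> (b \<rightarrow> d) = (a \<squnion> b) \<rightarrow> d"
    and bot_imp: "\<bottom> \<rightarrow> a = \<top>"
    and imp_top: "a \<rightarrow> \<top> = \<top>"
    and modus_ponens: "a \<sqinter> (a \<rightarrow> b) \<le> b"

locale tense_dli_plus = dli_plus imp
  for imp :: "'a::{distrib_lattice, bounded_lattice} \<Rightarrow> 'a \<Rightarrow> 'a" (infixr "\<rightarrow>" 75) +
  fixes G H F P :: "'a \<Rightarrow> 'a"
  assumes P_G_adjoint: "P x \<le> y \<longleftrightarrow> x \<le> G y"
    and F_H_adjoint: "F x \<le> y \<longleftrightarrow> x \<le> H y"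
    and G_inf_F: "G x \<sqinter> F y \<le> F (x \<sqinter> y)"
    and H_inf_P: "H x \<sqinter> P y \<le> P (x \<sqinter> y)"
    and G_sup: "G (x \<squnion> y) \<le> G x \<squnion> F y"
    and H_sup: "H (x \<squnion> y) \<le> H x \<squnion> P y"
    and G_imp: "G (x \<rightarrow> y) \<le> G x \<rightarrow> G y"
    and H_imp: "H (x \<rightarrow> y) \<le> H x \<rightarrow> H y"
    and G_imp_F: "G (x \<rightarrow> y) \<le> F x \<rightarrow> F y"
    and H_imp_P: "H (x \<rightarrow> y) \<le> P x \<rightarrow> P y"

text \<open>Congruences of the algebra with universe \<open>A\<close>, constants \<open>C\<close>, unary operations \<open>U\<close> and binary
  operations \<open>B\<close>. The operations are total functions on the type, but only their values on \<open>A\<close>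
  matter, since \<open>equiv A \<theta>\<close> includes \<open>\<theta> \<subseteq> A \<times> A\<close>.\<close>

definition congruences ::
  "'b set \<Rightarrow> 'b set \<Rightarrow> ('b \<Rightarrow> 'b) set \<Rightarrow> ('b \<Rightarrow> 'b \<Rightarrow> 'b) set \<Rightarrow> ('b \<times> 'b) set set" where
  "congruences A C U B = {\<theta>. equiv A \<theta>
     \<and> (\<forall>c\<in>C. (c, c) \<in> \<theta>)
     \<and> (\<forall>u\<in>U. \<forall>x y. (x, y) \<in> \<theta> \<longrightarrow> (u x, u y) \<in> \<theta>)
     \<and> (\<forall>b\<in>B. \<forall>x y x' y'. (x, y) \<in> \<theta> \<longrightarrow> (x', y') \<in> \<theta> \<longrightarrow> (b x x', b y y') \<in> \<theta>)}"

definition Con :: "('a::{distrib_lattice, bounded_lattice} \<Rightarrow> 'a \<Rightarrow> 'a)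
    \<Rightarrow> ('a \<Rightarrow> 'a) \<Rightarrow> ('a \<Rightarrow> 'a) \<Rightarrow> ('a \<Rightarrow> 'a) \<Rightarrow> ('a \<Rightarrow> 'a) \<Rightarrow> ('a \<times> 'a) set set" where
  "Con imp G H F P = congruences UNIV {\<bottom>, \<top>} {G, H, F, P} {(\<sqinter>), (\<squnion>), imp}"

definition K_carrier :: "('a::{distrib_lattice, bounded_lattice} \<times> 'a) set" where
  "K_carrier = {(a, b). a \<sqinter> b = \<bottom>}"

definition K_sup :: "'a::{distrib_lattice, bounded_lattice} \<times> 'a \<Rightarrow> 'a \<times> 'a \<Rightarrow> 'a \<times> 'a" where
  "K_sup = (\<lambda>(a, b) (x, y). (a \<squnion> x, b \<sqinter> y))"

definition K_inf :: "'a::{distrib_lattice, bounded_lattice} \<times> 'a \<Rightarrow> 'a \<times> 'a \<Rightarrow> 'a \<times> 'a" where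
  "K_inf = (\<lambda>(a, b) (x, y). (a \<sqinter> x, b \<squnion> y))"

definition K_imp :: "('a::{distrib_lattice, bounded_lattice} \<Rightarrow> 'a \<Rightarrow> 'a)
    \<Rightarrow> 'a \<times> 'a \<Rightarrow> 'a \<times> 'a \<Rightarrow> 'a \<times> 'a" where
  "K_imp imp = (\<lambda>(a, b) (x, y). (imp a x \<sqinter> imp y b, a \<sqinter> y))"

definition K_neg :: "'a \<times> 'a \<Rightarrow> 'a \<times> 'a" where
  "K_neg = (\<lambda>(a, b). (b, a))"

definition K_zero :: "'a::{distrib_lattice, bounded_lattice} \<times> 'a" where
  "K_zero = (\<bottom>, \<top>)"

definition K_one :: "'a::{distrib_lattice, bounded_lattice} \<times> 'a" where
  "K_one = (\<top>, \<bottom>)"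

definition K_center :: "'a::{distrib_lattice, bounded_lattice} \<times> 'a" where
  "K_center = (\<bottom>, \<bottom>)"

definition K_G :: "('a \<Rightarrow> 'a) \<Rightarrow> ('a \<Rightarrow> 'a) \<Rightarrow> 'a \<times> 'a \<Rightarrow> 'a \<times> 'a" where
  "K_G G F = (\<lambda>(a, b). (G a, F b))"

definition K_H :: "('a \<Rightarrow> 'a) \<Rightarrow> ('a \<Rightarrow> 'a) \<Rightarrow> 'a \<times> 'a \<Rightarrow> 'a \<times> 'a" where
  "K_H H P = (\<lambda>(a, b). (H a, P b))"

definition Con_K :: "('a::{distrib_lattice, bounded_lattice} \<Rightarrow> 'a \<Rightarrow> 'a)
    \<Rightarrow> ('a \<Rightarrow> 'a) \<Rightarrow> ('a \<Rightarrow> 'a) \<Rightarrow> ('a \<Rightarrow> 'a) \<Rightarrow> ('a \<Rightarrow> 'a)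
    \<Rightarrow> (('a \<times> 'a) \<times> ('a \<times> 'a)) set set" where
  "Con_K imp G H F P = congruences K_carrier {K_zero, K_one, K_center}
     {K_neg, K_G G F, K_H H P} {K_inf, K_sup, K_imp imp}"

definition gamma :: "('a::{distrib_lattice, bounded_lattice} \<times> 'a) set
    \<Rightarrow> (('a \<times> 'a) \<times> ('a \<times> 'a)) set" where
  "gamma \<theta> = {((a, b), (x, y)) | a b x y.
     (a, b) \<in> K_carrier \<and> (x, y) \<in> K_carrier \<and> (a, x) \<in> \<theta> \<and> (b, y) \<in> \<theta>}"

definition order_isomorphism :: "'p::order set \<Rightarrow> 'q::order set \<Rightarrow> ('p \<Rightarrow> 'q) \<Rightarrow> bool" where
  "order_isomorphism X Y f \<longleftrightarrow>
     bij_betw f X Y \<and> (\<forall>x\<in>X. \<forall>y\<in>X. x \<le> y \<longleftrightarrow> f x \<le> f y)"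

end

theory Submission
  imports Defs
begin

text \<open>A congruence \<open>\<gamma>\<close> of the algebra of pairs is recovered from its restriction to the pairs \<open>(a, 0)\<close>,
  which are the elements above the center \<open>c\<close>: joining with \<open>c\<close> sends \<open>(a, b)\<close> to \<open>(a, 0)\<close>, and meeting with
  \<open>c\<close> sends it to \<open>(0, b) = \<sim>(b, 0)\<close>. Conversely, if \<open>u \<squnion> c\<close>, \<open>v \<squnion> c\<close> and \<open>u \<sqinter> c\<close>, \<open>v \<sqinter> c\<close> are
  identified, then so are \<open>u\<close> and \<open>v\<close>, by cancellation in the distributive lattice of \<open>\<gamma>\<close>-classes.\<close>

definition central_trace :: "(('a::{distrib_lattice, bounded_lattice} \<times> 'a) \<times> ('a \<times> 'a)) set
    \<Rightarrow> ('a \<times> 'a) set" where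
  "central_trace \<gamma> = {(a, x). ((a, \<bottom>), (x, \<bottom>)) \<in> \<gamma>}"

lemma congruencesI:
  assumes "equiv A \<theta>"
    and "\<And>c. c \<in> C \<Longrightarrow> (c, c) \<in> \<theta>"
    and "\<And>u x y. u \<in> U \<Longrightarrow> (x, y) \<in> \<theta> \<Longrightarrow> (u x, u y) \<in> \<theta>"
    and "\<And>b x y x' y'. b \<in> B \<Longrightarrow> (x, y) \<in> \<theta> \<Longrightarrow> (x', y') \<in> \<theta> \<Longrightarrow> (b x x', b y y') \<in> \<theta>"
  shows "\<theta> \<in> congruences A C U B"
  using assms by (simp add: congruences_def)

lemma congruences_cong_unary:
  "\<theta> \<in> congruences A C U B \<Longrightarrow> u \<in> U \<Longrightarrow> (x, y) \<in> \<theta> \<Longrightarrow> (u x, u y) \<in> \<theta>"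
  by (auto simp: congruences_def)

lemma congruences_cong_binary:
  "\<theta> \<in> congruences A C U B \<Longrightarrow> b \<in> B \<Longrightarrow> (x, y) \<in> \<theta> \<Longrightarrow> (x', y') \<in> \<theta> \<Longrightarrow> (b x x', b y y') \<in> \<theta>"
  by (auto simp: congruences_def)

lemma congruences_equiv: "\<theta> \<in> congruences A C U B \<Longrightarrow> equiv A \<theta>"
  by (simp add: congruences_def)

lemma mem_gamma_iff:
  "((a, b), (x, y)) \<in> gamma \<theta> \<longleftrightarrow> a \<sqinter> b = \<bottom> \<and> x \<sqinter> y = \<bottom> \<and> (a, x) \<in> \<theta> \<and> (b, y) \<in> \<theta>"
  by (auto simp: gamma_def K_carrier_def)

text \<open>For pairs \<open>(a, \<bottom>)\<close> and \<open>(x, \<bottom>)\<close> the condition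
  on second components in \<open>gamma\<close> is
  \<open>(\<bottom>, \<bottom>) \<in> \<theta>\<close>, which reflexivity supplies.\<close>

lemma central_trace_gamma: "\<theta> \<in> Con imp G H F P \<Longrightarrow> central_trace (gamma \<theta>) = \<theta>"
  by (auto simp: central_trace_def mem_gamma_iff Con_def congruences_def)

lemma equiv_gamma:
  assumes "equiv UNIV \<theta>"
  shows "equiv K_carrier (gamma \<theta>)"
proof (rule equivI)
  show "gamma \<theta> \<subseteq> K_carrier \<times> K_carrier"
    by (auto simp: gamma_def)
  show "refl_on K_carrier (gamma \<theta>)"
    using assms by (auto simp: equiv_def refl_on_def mem_gamma_iff K_carrier_def)
  show "sym (gamma \<theta>)"
    using assms by (auto simp: equiv_def sym_def mem_gamma_iff)
  show "trans (gamma \<theta>)"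
    using assms by (auto simp: equiv_def mem_gamma_iff intro!: transI elim: transE)
qed

text \<open>Every \<open>(a, \<bottom>)\<close> lies in the carrier, so reflexivity of \<gamma> on
  the carrier gives reflexivity on the whole type.\<close>

lemma equiv_central_trace:
  assumes "equiv K_carrier \<gamma>"
  shows "equiv UNIV (central_trace \<gamma>)"
proof (rule equivI)
  show "refl (central_trace \<gamma>)"
    using assms by (auto simp: equiv_def refl_on_def central_trace_def K_carrier_def)
  show "sym (central_trace \<gamma>)"
    using assms by (auto simp: equiv_def sym_def central_trace_def)
  show "trans (central_trace \<gamma>)"
    using assms by (auto simp: equiv_def central_trace_def intro!: transI elim: transE)
qed simp

lemma K_sup_in_K_carrier: "u \<in> K_carrier \<Longrightarrow> v \<in> K_carrier \<Longrightarrow> K_sup u v \<in> K_carrier"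
proof -
  have "(a \<squnion> x) \<sqinter> (b \<sqinter> y) = \<bottom>" if "a \<sqinter> b = \<bottom>" "x \<sqinter> y = \<bottom>" for a b x y :: 'a
  proof -
    \<comment> \<open>After distributing, each summand contains one of the two meets assumed to be
      0.\<close>
    have "(a \<squnion> x) \<sqinter> (b \<sqinter> y) = ((a \<sqinter> b) \<sqinter> y) \<squnion> ((x \<sqinter> y) \<sqinter> b)"
      by (simp add: inf_sup_distrib1 inf_sup_distrib2 inf_assoc inf_commute inf_left_commute)
    then show ?thesis
      using that by simp
  qed
  then show "u \<in> K_carrier \<Longrightarrow> v \<in> K_carrier \<Longrightarrow> K_sup u v \<in> K_carrier"
    by (auto simp: K_sup_def K_carrier_def)
qed

lemma K_neg_in_K_carrier: "u \<in> K_carrier \<Longrightarrow> K_neg u \<in> K_carrier"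
  by (auto simp: K_neg_def K_carrier_def inf_commute)

text \<open>De Morgan duality under the involution; it reduces closure of the carrier under meets to
  closure under joins.\<close>

lemma K_inf_eq: "K_inf u v = K_neg (K_sup (K_neg u) (K_neg v))"
  by (simp add: K_inf_def K_sup_def K_neg_def split: prod.split)

lemma K_inf_in_K_carrier: "u \<in> K_carrier \<Longrightarrow> v \<in> K_carrier \<Longrightarrow> K_inf u v \<in> K_carrier"
  by (simp add: K_inf_eq K_sup_in_K_carrier K_neg_in_K_carrier)

text \<open>The meet of the two components lies below a, a \<rightarrow> x and y. Modus ponens
  therefore puts it below x \<sqinter> y, which is 0.\<close>

lemma (in dli_plus) K_imp_in_K_carrier:
  assumes "u \<in> K_carrier" "v \<in> K_carrier"
  shows "K_imp imp u v \<in> K_carrier"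
proof -
  have "((a \<rightarrow> x) \<sqinter> (y \<rightarrow> b)) \<sqinter> (a \<sqinter> y) = \<bottom>" if "x \<sqinter> y = \<bottom>" for a b x y
  proof -
    have "((a \<rightarrow> x) \<sqinter> (y \<rightarrow> b)) \<sqinter> (a \<sqinter> y) \<le> (a \<sqinter> (a \<rightarrow> x)) \<sqinter> y"
      by (auto intro: le_infI1 le_infI2)
    also have "\<dots> \<le> x \<sqinter> y"
      by (rule inf_mono[OF modus_ponens order_refl])
    finally show ?thesis
      using that by (simp add: bot_unique)
  qed
  then show ?thesis
    using assms by (auto simp: K_imp_def K_carrier_def)
qed

context
  fixes \<gamma> :: "(('a::{distrib_lattice, bounded_lattice} \<times> 'a) \<times> ('a \<times> 'a)) set"
    and imp G H F P
  assumes con: "\<gamma> \<in> Con_K imp G H F P"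
begin

lemma Con_K_equiv: "equiv K_carrier \<gamma>"
  using con unfolding Con_K_def by (rule congruences_equiv)

lemma Con_K_cong:
  shows "(u, v) \<in> \<gamma> \<Longrightarrow> (K_neg u, K_neg v) \<in> \<gamma>"
    and "(u, v) \<in> \<gamma> \<Longrightarrow> (K_G G F u, K_G G F v) \<in> \<gamma>"
    and "(u, v) \<in> \<gamma> \<Longrightarrow> (K_H H P u, K_H H P v) \<in> \<gamma>"
    and "(u, v) \<in> \<gamma> \<Longrightarrow> (u', v') \<in> \<gamma> \<Longrightarrow> (K_inf u u', K_inf v v') \<in> \<gamma>"
    and "(u, v) \<in> \<gamma> \<Longrightarrow> (u', v') \<in> \<gamma> \<Longrightarrow> (K_sup u u', K_sup v v') \<in> \<gamma>"
    and "(u, v) \<in> \<gamma> \<Longrightarrow> (u', v') \<in> \<gamma> \<Longrightarrow> (K_imp imp u u', K_imp imp v v') \<in> \<gamma>"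
  using con unfolding Con_K_def
  by (auto intro: congruences_cong_unary congruences_cong_binary)

text \<open>Modulo \<gamma>, u = u \<sqinter> (u \<squnion> w) = u \<sqinter> (v \<squnion> w) = (u
  \<sqinter> v) \<squnion> (u \<sqinter> w) = (v \<sqinter> u) \<squnion> (v \<sqinter> w) = v
  \<sqinter> (u \<squnion> w) = v \<sqinter> (v \<squnion> w) = v, with the operations taken on
  pairs.\<close>

lemma Con_K_cancel:
  assumes "u \<in> K_carrier" "v \<in> K_carrier" "w \<in> K_carrier"
    and sup: "(K_sup u w, K_sup v w) \<in> \<gamma>" and inf: "(K_inf u w, K_inf v w) \<in> \<gamma>"
  shows "(u, v) \<in> \<gamma>"
proof -
  have refl: "(z, z) \<in> \<gamma>" if "z \<in> K_carrier" for z
    using Con_K_equiv that by (auto simp: equiv_def refl_on_def)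
  have absorb: "K_inf z (K_sup z w) = z" for z :: "'a \<times> 'a"
    by (cases z; cases w) (simp add: K_inf_def K_sup_def)
  have distrib: "K_inf p (K_sup q w) = K_sup (K_inf p q) (K_inf p w)" for p q :: "'a \<times> 'a"
    by (cases p; cases q; cases w)
      (simp add: K_inf_def K_sup_def, intro conjI inf_sup_distrib1 sup_inf_distrib1)
  have comm: "K_inf p q = K_inf q p" for p q :: "'a \<times> 'a"
    by (cases p; cases q) (simp add: K_inf_def inf_commute sup_commute)
  have "(u, K_inf u (K_sup v w)) \<in> \<gamma>"
    using Con_K_cong(4)[OF refl[OF assms(1)] sup] by (simp add: absorb)
  moreover have "(K_inf u (K_sup v w), K_inf v (K_sup u w)) \<in> \<gamma>"
    unfolding distrib comm[of v u]
    by (intro Con_K_cong(5) refl inf K_inf_in_K_carrier assms)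
  moreover have "(K_inf v (K_sup u w), v) \<in> \<gamma>"
    using Con_K_cong(4)[OF refl[OF assms(2)] sup] by (simp add: absorb)
  ultimately show ?thesis
    using Con_K_equiv unfolding equiv_def by (meson transD)
qed

lemma gamma_central_trace: "gamma (central_trace \<gamma>) = \<gamma>"
proof -
  have center: "(K_center, K_center) \<in> \<gamma>"
    using con by (auto simp: Con_K_def congruences_def)
  have left: "((a, \<bottom>), (x, \<bottom>)) \<in> \<gamma>" if "((a, b), (x, y)) \<in> \<gamma>" for a b x y
    using Con_K_cong(5)[OF that center] by (simp add: K_sup_def K_center_def)
  have swap: "((b, a), (y, x)) \<in> \<gamma>" if "((a, b), (x, y)) \<in> \<gamma>" for a b x y
    using Con_K_cong(1)[OF that] by (simp add: K_neg_def)
  have "((a, b), (x, y)) \<in> gamma (central_trace \<gamma>) \<longleftrightarrow> ((a, b), (x, y)) \<in> \<gamma>" for a b x y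
  proof
    assume "((a, b), (x, y)) \<in> gamma (central_trace \<gamma>)"
    then have carrier: "(a, b) \<in> K_carrier" "(x, y) \<in> K_carrier"
      and trace: "((a, \<bottom>), (x, \<bottom>)) \<in> \<gamma>" "((b, \<bottom>), (y, \<bottom>)) \<in> \<gamma>"
      by (auto simp: mem_gamma_iff K_carrier_def central_trace_def)
    show "((a, b), (x, y)) \<in> \<gamma>"
    proof (rule Con_K_cancel[OF carrier, where w = K_center])
      show "(K_sup (a, b) K_center, K_sup (x, y) K_center) \<in> \<gamma>"
        using trace(1) by (simp add: K_sup_def K_center_def)
      show "(K_inf (a, b) K_center, K_inf (x, y) K_center) \<in> \<gamma>"
        using swap[OF trace(2)] by (simp add: K_inf_def K_center_def)
    qed (simp add: K_center_def K_carrier_def)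
  next
    assume *: "((a, b), (x, y)) \<in> \<gamma>"
    then have "(a, b) \<in> K_carrier" "(x, y) \<in> K_carrier"
      using equiv_type[OF Con_K_equiv] by auto
    then show "((a, b), (x, y)) \<in> gamma (central_trace \<gamma>)"
      \<comment> \<open>Negation first moves the second components to the front, where joining with
        the center isolates them.\<close>
      using left[OF *] left[OF swap[OF *]]
      by (simp add: mem_gamma_iff K_carrier_def central_trace_def)
  qed
  then show ?thesis
    by (simp add: set_eq_iff split_paired_all)
qed

end

context tense_dli_plus
begin

text \<open>As a left adjoint of \<open>H\<close>, \<open>F\<close> preserves 0, so the bound
  \<open>F (a \<sqinter> b)\<close> from \<open>G_inf_F\<close> collapses. This keeps
  \<open>K_G G F\<close> inside the carrier.\<close>

lemma G_inf_F_eq_bot: "a \<sqinter> b = \<bottom> \<Longrightarrow> G a \<sqinter> F b = \<bottom>"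
  using G_inf_F[of a b] F_H_adjoint[of \<bottom> \<bottom>] by (simp add: bot_unique)

lemma H_inf_P_eq_bot: "a \<sqinter> b = \<bottom> \<Longrightarrow> H a \<sqinter> P b = \<bottom>"
  using H_inf_P[of a b] P_G_adjoint[of \<bottom> \<bottom>] by (simp add: bot_unique)

text \<open>Each component of an operation on pairs is a term of the original algebra in the
  components of its arguments, so \<theta> respects it. What remains is that the operations stay in
  the carrier.\<close>

lemma gamma_in_Con_K:
  assumes \<theta>: "\<theta> \<in> Con imp G H F P"
  shows "gamma \<theta> \<in> Con_K imp G H F P"
proof -
  have equiv: "equiv K_carrier (gamma \<theta>)"
    using \<theta> unfolding Con_def by (intro equiv_gamma congruences_equiv)
  have refl: "(a, a) \<in> \<theta>" for a
    using congruences_equiv[OF \<theta>[unfolded Con_def]] by (auto simp: equiv_def refl_on_def)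
  have un: "(u x, u y) \<in> \<theta>" if "(x, y) \<in> \<theta>" "u \<in> {G, H, F, P}" for u x y
    using \<theta> that unfolding Con_def by (blast intro: congruences_cong_unary)
  have bin: "(b x x', b y y') \<in> \<theta>"
    if "(x, y) \<in> \<theta>" "(x', y') \<in> \<theta>" "b \<in> {(\<sqinter>), (\<squnion>), imp}" for b x y x' y'
    using \<theta> that unfolding Con_def by (blast intro: congruences_cong_binary)
  have mem: "(u, v) \<in> gamma \<theta> \<longleftrightarrow>
      u \<in> K_carrier \<and> v \<in> K_carrier \<and> (fst u, fst v) \<in> \<theta> \<and> (snd u, snd v) \<in> \<theta>" for u v
    by (cases u; cases v) (simp add: mem_gamma_iff K_carrier_def)
  have constants: "(c, c) \<in> gamma \<theta>" if "c \<in> {K_zero, K_one, K_center}" for c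
    using that by (auto simp: mem_gamma_iff refl K_zero_def K_one_def K_center_def)
  have unary: "(k u, k v) \<in> gamma \<theta>"
    if "k \<in> {K_neg, K_G G F, K_H H P}" "(u, v) \<in> gamma \<theta>" for k u v
    using that
    by (cases u; cases v)
      (auto simp: mem_gamma_iff K_neg_def K_G_def K_H_def un
        G_inf_F_eq_bot H_inf_P_eq_bot, simp_all add: inf_commute)
  have binary: "(k u u', k v v') \<in> gamma \<theta>"
    if k: "k \<in> {K_inf, K_sup, K_imp imp}" and "(u, v) \<in> gamma \<theta>" "(u', v') \<in> gamma \<theta>"
    for k u v u' v'
  proof -
    have "k u u' \<in> K_carrier" "k v v' \<in> K_carrier"
      using that by (auto simp: mem K_inf_in_K_carrier K_sup_in_K_carrier K_imp_in_K_carrier)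
    moreover have "(fst (k u u'), fst (k v v')) \<in> \<theta>" "(snd (k u u'), snd (k v v')) \<in> \<theta>"
      using that
      by (auto simp: mem K_inf_def K_sup_def K_imp_def bin split: prod.splits)
    ultimately show ?thesis
      by (simp add: mem)
  qed
  show ?thesis
    unfolding Con_K_def by (rule congruencesI) (fact equiv constants unary binary)+
qed

text \<open>Each operation of the original algebra is recovered on pairs
  \<open>(a, \<bottom>)\<close> as a term in the operations on pairs, so \<gamma> respects
  it.\<close>

lemma central_trace_in_Con:
  assumes bot: "G \<bottom> = \<bottom>" "H \<bottom> = \<bottom>" and \<gamma>: "\<gamma> \<in> Con_K imp G H F P"
  shows "central_trace \<gamma> \<in> Con imp G H F P"
proof -
  note cong = Con_K_cong[OF \<gamma>]
  \<comment> \<open>Left adjoints preserve 0; hence \<open>K_G\<close> and \<open>K_H\<close> keep a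
    second component 0.\<close>
  have bot': "F \<bottom> = \<bottom>" "P \<bottom> = \<bottom>"
    using F_H_adjoint[of \<bottom> \<bottom>] P_G_adjoint[of \<bottom> \<bottom>] by (simp_all add: bot_unique)
  have equiv: "equiv UNIV (central_trace \<gamma>)"
    by (rule equiv_central_trace[OF Con_K_equiv[OF \<gamma>]])
  then have constants: "(c, c) \<in> central_trace \<gamma>" if "c \<in> {\<bottom>, \<top>}" for c
    by (auto simp: equiv_def refl_on_def)
  have unary: "(u a, u x) \<in> central_trace \<gamma>"
    if u: "u \<in> {G, H, F, P}" and "(a, x) \<in> central_trace \<gamma>" for u a x
  proof -
    have *: "((a, \<bottom>), (x, \<bottom>)) \<in> \<gamma>"
      using that by (simp add: central_trace_def)
    have "((G a, \<bottom>), (G x, \<bottom>)) \<in> \<gamma>" "((H a, \<bottom>), (H x, \<bottom>)) \<in> \<gamma>"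
      using cong(2)[OF *] cong(3)[OF *] by (simp_all add: K_G_def K_H_def bot')
    \<comment> \<open>\<open>F\<close> and \<open>P\<close> act on second components, so they are
      reached by conjugating \<open>K_G\<close> and \<open>K_H\<close> with negation: (a, 0) goes to
      (0, a), then to (G 0, F a) or (H 0, P a), and back. Here G 0 = 0 = H 0 makes the result (F a,
      0) or (P a, 0).\<close>
    moreover have "((F a, \<bottom>), (F x, \<bottom>)) \<in> \<gamma>" "((P a, \<bottom>), (P x, \<bottom>)) \<in> \<gamma>"
      using cong(1)[OF cong(2)[OF cong(1)[OF *]]] cong(1)[OF cong(3)[OF cong(1)[OF *]]]
      by (simp_all add: K_G_def K_H_def K_neg_def bot)
    ultimately show ?thesis
      using u by (auto simp: central_trace_def)
  qed
  have binary: "(b a a', b x x') \<in> central_trace \<gamma>"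
    if b: "b \<in> {(\<sqinter>), (\<squnion>), imp}" and "(a, x) \<in> central_trace \<gamma>" "(a', x') \<in> central_trace \<gamma>"
    for b a a' x x'
  proof -
    have *: "((a, \<bottom>), (x, \<bottom>)) \<in> \<gamma>" "((a', \<bottom>), (x', \<bottom>)) \<in> \<gamma>"
      using that by (simp_all add: central_trace_def)
    show ?thesis
      using b cong(4)[OF *] cong(5)[OF *] cong(6)[OF *]
      \<comment> \<open>For implication, the extra factor 0 \<rightarrow> 0 in the first component
        is 1 by \<open>bot_imp\<close>, leaving (a \<rightarrow> a', 0).\<close>
      by (auto simp: central_trace_def K_inf_def K_sup_def K_imp_def bot_imp)
  qed
  show ?thesis
    unfolding Con_def by (rule congruencesI) (fact equiv constants unary binary)+
qed

end

theorem theorem7p2: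
  fixes imp :: "'a::{distrib_lattice, bounded_lattice} \<Rightarrow> 'a \<Rightarrow> 'a"
    and G H F P :: "'a \<Rightarrow> 'a"
  assumes "tense_dli_plus imp G H F P"
    and "G \<bottom> = \<bottom>" and "H \<bottom> = \<bottom>"
  shows "order_isomorphism (Con imp G H F P) (Con_K imp G H F P) gamma"
proof -
  interpret tense_dli_plus imp G H F P
    by (rule assms(1))
  have "bij_betw gamma (Con imp G H F P) (Con_K imp G H F P)"
    by (rule bij_betw_byWitness[where f' = central_trace])
      (auto simp: central_trace_gamma gamma_central_trace assms(2,3)
        intro: gamma_in_Con_K central_trace_in_Con)
  moreover have "\<theta> \<le> \<theta>' \<longleftrightarrow> gamma \<theta> \<le> gamma \<theta>'"
    if "\<theta> \<in> Con imp G H F P" "\<theta>' \<in> Con imp G H F P" for \<theta> \<theta>'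
  proof
    show "gamma \<theta> \<le> gamma \<theta>'" if "\<theta> \<le> \<theta>'"
      using that by (auto simp: gamma_def)
    show "\<theta> \<le> \<theta>'" if "gamma \<theta> \<le> gamma \<theta>'"
    proof -
      \<comment> \<open>The inverse map is monotone as well, so it carries the inclusion
        back.\<close>
      have "central_trace (gamma \<theta>) \<subseteq> central_trace (gamma \<theta>')"
        using that by (auto simp: central_trace_def)
      then show ?thesis
        using \<open>\<theta> \<in> _\<close> \<open>\<theta>' \<in> _\<close> by (simp add: central_trace_gamma)
    qed
  qed
  ultimately show ?thesis
    by (simp add: order_isomorphism_def)
qed

end
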